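(* Let $n=2$ and $k_u,k_v\in\mathbb{Z}_{>0}$. A generic regular system $\Sigma=\{P_1,P_2\}$ of two tropical linear differential equations in two unknowns $u,v$, each of differential order $(k_u,k_v)$, has at most $$\frac{(k_u+k_v)(k_u+k_v+1)}{2}$$ minimal solutions.
   Context: Let $n\ge1$ and $k_1,\dots,k_n\in\mathbb{Z}_{>0}$ (here $n=2$, $u_1=u$, $u_2=v$, $k_1=k_u$, $k_2=k_v$). A system $\Sigma=\{P_1,\dots,P_n\}$ consists of $P_l=\min_{1\le j\le n,\,0\le i\le k_j}\{a_{ijl}+u_j^{(i)}\}$ with $a_{ijl}\in\mathbb{Z}$, $1\le l\le n$. For $S\subseteq\mathbb{Z}_{\ge0}$, $\mathrm{val}_S(i)=\min\{s-i:s\in S,\ s\ge i\}$ ($\infty$ if no such $s$). A tuple $(S_1,\dots,S_n)\ne(\emptyset,\dots,\emptyset)$ of subsets of $\mathbb{Z}_{\ge0}$ is a (nonzero) solution of $\Sigma$ if for every $l$ the minimum $\min_{j,i}\{a_{ijl}+\mathrm{val}_{S_j}(i)\}$ is attained for at least two index pairs $(i,j)$. A minimal solution is a nonzero solution minimal for componentwise inclusion among nonzero solutions. For $j\in[n]$ and $\alpha\ge0$ put $A_{\alpha,j}(P_l)=\min_{0\le i\le\min\{\alpha,k_j\}}\{a_{ijl}+\alpha-i\}$. $P_l$ is regular if: (1) for every $j$ and every $0\le\alpha\le k_j$ the minimum defining $A_{\alpha,j}(P_l)$ is attained exactly once; and (2) the numbers $A_{\alpha,j}(P_l)$, $1\le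 j\le n$, $0\le\alpha<k_j$, are pairwise distinct. $\Sigma$ is regular if all $P_l$ are regular. $\Sigma$ is generic if the sums $\sum_{1\le j\le n}A_{k_{\sigma(j)},\sigma(j)}(P_j)$, $\sigma\in \mathrm{Sym}(n)$, are pairwise distinct, and for all $l_1\ne l_2$, all $j,j_1,j_2\in[n]$ and all $0\le\alpha<k_{j_1}$, $0\le\beta<k_{j_2}$ one has $A_{k_j,j}(P_{l_1})-A_{\alpha,j_1}(P_{l_1})\ne A_{k_j,j}(P_{l_2})-A_{\beta,j_2}(P_{l_2})$. *)

theory Defs
  imports "HOL-Analysis.Analysis" "HOL-Combinatorics.Permutations"
begin

text \<open>
  The finite index type \<open>'n\<close> enumerates both the unknowns and the equations, so \<open>n = CARD('n)\<close>.
  A polynomial of order \<open>k\<close> is given by its coefficients: \<open>P i j\<close> is the coefficient of the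
  \<open>i\<close>-th derivative of the \<open>j\<close>-th unknown. Only the values with \<open>i \<le> k j\<close> are ever used.
  For two unknowns \<open>u, v\<close> the index type is \<open>2\<close>, with \<open>1\<close> for \<open>u\<close> and \<open>2\<close> (which equals \<open>0\<close>) for \<open>v\<close>.
\<close>

type_synonym 'n tldp = "nat \<Rightarrow> 'n \<Rightarrow> int"
type_synonym 'n tlds = "'n \<Rightarrow> 'n tldp"

definition argmins :: "('a \<Rightarrow> 'b::linorder) \<Rightarrow> 'a set \<Rightarrow> 'a set" where
  "argmins f I = {p \<in> I. f p = Min (f ` I)}"

text \<open>The infimum of the empty set in \<^typ>\<open>enat\<close> is \<open>\<infinity>\<close>.\<close>

definition val :: "nat set \<Rightarrow> nat \<Rightarrow> enat" where
  "val S i = Inf {enat (s - i) |s. s \<in> S \<and> i \<le> s}"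

definition term_value :: "'n tldp \<Rightarrow> ('n \<Rightarrow> nat set) \<Rightarrow> nat \<times> 'n \<Rightarrow> ereal" where
  "term_value P S = (\<lambda>(i, j). ereal (real_of_int (P i j)) + ereal_of_enat (val (S j) i))"

definition is_solution :: "('n::finite \<Rightarrow> nat) \<Rightarrow> 'n tlds \<Rightarrow> ('n \<Rightarrow> nat set) \<Rightarrow> bool" where
  "is_solution k P S \<longleftrightarrow>
     (\<exists>j. S j \<noteq> {}) \<and>
     (\<forall>l. card (argmins (term_value (P l) S) {(i, j). i \<le> k j}) \<ge> 2)"

definition is_minimal_solution :: "('n::finite \<Rightarrow> nat) \<Rightarrow> 'n tlds \<Rightarrow> ('n \<Rightarrow> nat set) \<Rightarrow> bool" where
  "is_minimal_solution k P S \<longleftrightarrow>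
     is_solution k P S \<and>
     (\<forall>T. is_solution k P T \<and> (\<forall>j. T j \<subseteq> S j) \<longrightarrow> T = S)"

text \<open>The number \<open>A\<^bsub>\<alpha>,j\<^esub>(P)\<close>: the value at \<open>{\<alpha>}\<close> of the part of \<open>P\<close> in the \<open>j\<close>-th unknown.\<close>

definition A_val :: "('n \<Rightarrow> nat) \<Rightarrow> nat \<Rightarrow> 'n \<Rightarrow> 'n tldp \<Rightarrow> int" where
  "A_val k \<alpha> j P = Min ((\<lambda>i. P i j + int \<alpha> - int i) ` {0..min \<alpha> (k j)})"

definition regular_poly :: "('n::finite \<Rightarrow> nat) \<Rightarrow> 'n tldp \<Rightarrow> bool" where
  "regular_poly k P \<longleftrightarrow>
     (\<forall>j. \<forall>\<alpha>\<le>k j. card (argmins (\<lambda>i. P i j + int \<alpha> - int i) {0..min \<alpha> (k j)}) = 1) \<and>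
     inj_on (\<lambda>(\<alpha>, j). A_val k \<alpha> j P) {(\<alpha>, j). \<alpha> < k j}"

definition regular_system :: "('n::finite \<Rightarrow> nat) \<Rightarrow> 'n tlds \<Rightarrow> bool" where
  "regular_system k P \<longleftrightarrow> (\<forall>l. regular_poly k (P l))"

definition generic_system :: "('n::finite \<Rightarrow> nat) \<Rightarrow> 'n tlds \<Rightarrow> bool" where
  "generic_system k P \<longleftrightarrow>
     inj_on (\<lambda>\<sigma>. \<Sum>j\<in>UNIV. A_val k (k (\<sigma> j)) (\<sigma> j) (P j)) {\<sigma>. \<sigma> permutes UNIV} \<and>
     (\<forall>l\<^sub>1 l\<^sub>2 j j\<^sub>1 j\<^sub>2 \<alpha> \<beta>. l\<^sub>1 \<noteq> l\<^sub>2 \<and> \<alpha> < k j\<^sub>1 \<and> \<beta> < k j\<^sub>2 \<longrightarrow>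
        A_val k (k j) j (P l\<^sub>1) - A_val k \<alpha> j\<^sub>1 (P l\<^sub>1) \<noteq> A_val k (k j) j (P l\<^sub>2) - A_val k \<beta> j\<^sub>2 (P l\<^sub>2))"

end

theory Submission
  imports Defs
begin

text \<open>
  A tuple \<open>S\<close> is viewed as the set of its points \<open>(s, j)\<close>, \<open>s \<in> S j\<close>. The minimum of the terms of
  \<open>P\<close> at \<open>S\<close> is the minimum of the numbers \<open>A\<^bsub>s,j\<^esub>(P)\<close> over the points, and for regular \<open>P\<close>
  the points attaining it correspond bijectively to the index pairs attaining the minimum of the
  terms. So \<open>S\<close> is a solution iff for every equation the minimum over the points is attained at
  two points (\<open>is_solution_iff_points\<close>), and a minimal solution consists of the points of one
  attaining pair per equation.

  Call a point \<open>(s, j)\<close> small if \<open>s < k j\<close> and large otherwise. Small points have pairwise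
  distinct values, and at a large point the value is \<open>A\<^bsub>k j,j\<^esub>(P) + (s - k j)\<close>; hence every
  attaining pair contains a large point, and it contains no two large points of the same unknown.
  For two generic equations this forces a minimal solution to have exactly one
  large point for each unknown and one or two small points (\<open>minimal_solution_shape\<close>).

  Given the small points, the offsets \<open>x, y\<close> of the two large points satisfy, for \<open>l = 1, 2\<close>, that
  the minimum of \<open>a\<^sub>l + x\<close>, \<open>b\<^sub>l + y\<close>, \<open>c\<^sub>l\<close> is attained twice, where \<open>c\<^sub>l\<close> is the least value of
  a small point. Genericity says that all \<open>2 \<times> 2\<close> minors of this \<open>2 \<times> 3\<close> tropical system are
  nonsingular, so the two tropical lines meet in at most one point. A minimal solution is thus
  determined by its small points (\<open>minimal_solution_determined\<close>), a set of one or two of the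
  \<open>K = k 1 + k 2\<close> small points, and there are \<open>K + K (K - 1) / 2 = K (K + 1) / 2\<close> such sets.
\<close>

section \<open>Solutions as sets of points\<close>

text \<open>The minimum of \<open>f\<close> over \<open>X\<close> exists and is attained at least twice.\<close>

definition min_twice :: "('a \<Rightarrow> 'b::linorder) \<Rightarrow> 'a set \<Rightarrow> bool" where
  "min_twice f X \<longleftrightarrow> (\<exists>p\<in>X. \<exists>q\<in>X. p \<noteq> q \<and> f p = f q \<and> (\<forall>r\<in>X. f p \<le> f r))"

text \<open>The disjoint union of the components; the unknown is the second entry, as in index pairs.\<close>

definition points :: "('n \<Rightarrow> nat set) \<Rightarrow> (nat \<times> 'n) set" where
  "points S = {(s, j). s \<in> S j}"

text \<open>The number \<open>A\<^bsub>s,j\<^esub>(P)\<close> as a function of the point \<open>(s, j)\<close>.\<close>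

definition point_val :: "('n \<Rightarrow> nat) \<Rightarrow> 'n tldp \<Rightarrow> nat \<times> 'n \<Rightarrow> int" where
  "point_val k P = (\<lambda>(s, j). A_val k s j P)"

text \<open>The points of value below the order; all other points are called large.\<close>

definition small :: "('n \<Rightarrow> nat) \<Rightarrow> (nat \<times> 'n) set" where
  "small k = {(s, j). s < k j}"

lemma points_inject: "points S = points T \<Longrightarrow> S = T"
  unfolding points_def by (auto simp: set_eq_iff fun_eq_iff)

lemma card_argmins_ge_2_iff:
  assumes "finite I"
  shows "card (argmins f I) \<ge> 2 \<longleftrightarrow> min_twice f I"
proof
  assume "card (argmins f I) \<ge> 2"
  then obtain p q where "p \<in> argmins f I" "q \<in> argmins f I" "p \<noteq> q"
    by (metis card_2_iff' obtain_subset_with_card_n subsetD)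
  then show "min_twice f I"
    using assms unfolding min_twice_def argmins_def
    by (metis (mono_tags, lifting) Min_le finite_imageI imageI mem_Collect_eq)
next
  assume "min_twice f I"
  then obtain p q where pq: "p \<in> I" "q \<in> I" "p \<noteq> q" "f p = f q" "\<forall>r\<in>I. f p \<le> f r"
    unfolding min_twice_def by blast
  have "Min (f ` I) = f p"
    using pq assms by (intro Min_eqI) auto
  then have "{p, q} \<subseteq> argmins f I"
    using pq by (auto simp: argmins_def)
  then have "card {p, q} \<le> card (argmins f I)"
    using assms by (intro card_mono) (auto simp: argmins_def)
  then show "card (argmins f I) \<ge> 2"
    using pq by simp
qed

lemma A_val_le:
  assumes "i \<le> s" "i \<le> k j"
  shows "A_val k s j P \<le> P i j + int s - int i"
  unfolding A_val_def using assms by (intro Min_le) auto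

lemma A_val_attained:
  obtains i where "i \<le> s" "i \<le> k j" "A_val k s j P = P i j + int s - int i"
proof -
  have "A_val k s j P \<in> (\<lambda>i. P i j + int s - int i) ` {0..min s (k j)}"
    unfolding A_val_def by (intro Min_in) auto
  then show ?thesis using that by auto
qed

lemma A_val_above_order:
  assumes "k j \<le> s"
  shows "A_val k s j P = A_val k (k j) j P + int (s - k j)"
proof (rule antisym)
  obtain i where "i \<le> k j" "A_val k (k j) j P = P i j + int (k j) - int i"
    by (rule A_val_attained[of "k j" k j P])
  then show "A_val k s j P \<le> A_val k (k j) j P + int (s - k j)"
    using A_val_le[of i s k j P] assms by simp
next
  obtain i where "i \<le> k j" "A_val k s j P = P i j + int s - int i"
    by (rule A_val_attained[of s k j P])
  then show "A_val k (k j) j P + int (s - k j) \<le> A_val k s j P"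
    using A_val_le[of i "k j" k j P] assms by simp
qed

text \<open>
  Regularity speaks about \<open>s \<le> k j\<close> only. For larger \<open>s\<close> the numbers that are minimised are those
  for \<open>k j\<close>, shifted by a constant.
\<close>

lemma regular_minimizer_unique:
  assumes "regular_poly k P"
    and i: "i \<le> s" "i \<le> k j" "A_val k s j P = P i j + int s - int i"
    and i': "i' \<le> s" "i' \<le> k j" "A_val k s j P = P i' j + int s - int i'"
  shows "i = i'"
proof -
  define t where "t = min s (k j)"
  have A: "A_val k s j P = A_val k t j P + int (s - t)"
    using A_val_above_order[of k j s P] by (cases "k j \<le> s") (auto simp: t_def)
  have "card (argmins (\<lambda>i. P i j + int t - int i) {0..min t (k j)}) = 1"
    using assms(1) unfolding regular_poly_def by (simp add: t_def)
  moreover have "i \<in> argmins (\<lambda>i. P i j + int t - int i) {0..min t (k j)}"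
      "i' \<in> argmins (\<lambda>i. P i j + int t - int i) {0..min t (k j)}"
    using i i' A unfolding argmins_def A_val_def[of k t j P] by (auto simp: t_def)
  ultimately show ?thesis
    by (metis card_1_singletonE singletonD)
qed

lemma term_value_le:
  assumes "s \<in> S j" "i \<le> s"
  shows "term_value P S (i, j) \<le> ereal (real_of_int (P i j + int s - int i))"
proof -
  have "val (S j) i \<le> enat (s - i)"
    unfolding val_def using assms by (intro Inf_lower) auto
  then have "ereal_of_enat (val (S j) i) \<le> ereal (real (s - i))"
    by (metis ereal_of_enat_le_iff ereal_of_enat_simps(1))
  then have "term_value P S (i, j) \<le> ereal (real_of_int (P i j)) + ereal (real (s - i))"
    unfolding term_value_def prod.case by (rule add_left_mono)
  then show ?thesis using assms by (simp add: of_nat_diff add_diff_eq)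
qed

lemma term_value_cases:
  obtains "term_value P S (i, j) = \<infinity>"
  | s where "s \<in> S j" "i \<le> s"
      "term_value P S (i, j) = ereal (real_of_int (P i j + int s - int i))"
proof (cases "{enat (s - i) |s. s \<in> S j \<and> i \<le> s} = {}")
  case True
  then have "val (S j) i = \<infinity>"
    unfolding val_def by (simp only: Inf_enat_def refl if_True)
  then show ?thesis using that(1) by (simp add: term_value_def)
next
  case False
  then have "val (S j) i \<in> {enat (s - i) |s. s \<in> S j \<and> i \<le> s}"
    unfolding val_def by (meson equals0I wellorder_InfI)
  then obtain s where "s \<in> S j" "i \<le> s" "val (S j) i = enat (s - i)" by blast
  then show ?thesis using that(2)[of s] by (simp add: term_value_def of_nat_diff)
qed

text \<open>
  An index pair \<open>(i, j)\<close> attaining the minimum of the terms gives the point \<open>(s, j)\<close> with \<open>s\<close> the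
  least element of \<open>S j\<close> that is at least \<open>i\<close>; a point \<open>(s, j)\<close> attaining the minimum of the point values gives
  \<open>(i, j)\<close> with \<open>i\<close> the index attaining \<open>A\<^bsub>s,j\<^esub>(P)\<close>. The first map is injective because that
  index is unique, the second because \<open>P i j + s - i\<close> is strictly increasing in \<open>s\<close>.
\<close>

lemma min_twice_term_value_iff:
  fixes k :: "'n::finite \<Rightarrow> nat"
  assumes reg: "regular_poly k P" and ne: "points S \<noteq> {}"
  shows "min_twice (term_value P S) {(i, j). i \<le> k j} \<longleftrightarrow> min_twice (point_val k P) (points S)"
    (is "min_twice ?t ?I \<longleftrightarrow> min_twice ?A ?X")
proof
  have below: "\<exists>p\<in>?I. ?t p \<le> ereal (real_of_int (?A r))" if "r \<in> ?X" for r
  proof -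
    obtain s j where r: "r = (s, j)" "s \<in> S j"
      using \<open>r \<in> ?X\<close> by (auto simp: points_def)
    obtain i where "i \<le> s" "i \<le> k j" "A_val k s j P = P i j + int s - int i"
      by (rule A_val_attained)
    then show ?thesis
      using term_value_le[of s S j i P] r by (intro bexI[of _ "(i, j)"]) (auto simp: point_val_def)
  qed
  assume "min_twice ?t ?I"
  then obtain p q where pq: "p \<in> ?I" "q \<in> ?I" "p \<noteq> q" "?t p = ?t q" "\<forall>r\<in>?I. ?t p \<le> ?t r"
    unfolding min_twice_def by blast
  have lower: "?t p \<le> ereal (real_of_int (?A r))" if "r \<in> ?X" for r
    using below[OF that] pq(5) by (meson order_trans)
  then have fin: "?t p \<noteq> \<infinity>" using ne by fastforce
  obtain i j where p: "p = (i, j)" "i \<le> k j" using pq by auto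
  obtain i' j' where q: "q = (i', j')" "i' \<le> k j'" using pq by auto
  obtain s where s: "s \<in> S j" "i \<le> s" "?t p = ereal (real_of_int (P i j + int s - int i))"
    using fin p by (metis term_value_cases)
  obtain s' where s': "s' \<in> S j'" "i' \<le> s'" "?t q = ereal (real_of_int (P i' j' + int s' - int i'))"
    using fin q pq(4) by (metis term_value_cases)
  have X: "(s, j) \<in> ?X" "(s', j') \<in> ?X" using s s' by (auto simp: points_def)
  have lower_int: "P i j + int s - int i \<le> ?A r" if "r \<in> ?X" for r
    using lower[OF that] unfolding s(3) ereal_less_eq(3) of_int_le_iff .
  have eq: "P i j + int s - int i = P i' j' + int s' - int i'"
    using pq(4) unfolding s(3) s'(3) ereal.inject of_int_eq_iff .
  have A: "?A (s, j) = P i j + int s - int i" 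
    using A_val_le[of i s k j P] p s lower_int[OF X(1)] by (simp add: point_val_def)
  have A': "?A (s', j') = P i' j' + int s' - int i'"
    using A_val_le[of i' s' k j' P] q s' lower_int[OF X(2)] eq by (simp add: point_val_def)
  have "(s, j) \<noteq> (s', j')"
    using regular_minimizer_unique[OF reg, of i s j i'] A A' p q s s' pq(3)
    by (auto simp: point_val_def)
  then show "min_twice ?A ?X"
    unfolding min_twice_def using X A A' eq lower_int by metis
next
  assume "min_twice ?A ?X"
  then obtain s j s' j' where X: "(s, j) \<in> ?X" "(s', j') \<in> ?X" "(s, j) \<noteq> (s', j')"
    "?A (s, j) = ?A (s', j')" "\<forall>r\<in>?X. ?A (s, j) \<le> ?A r"
    unfolding min_twice_def by (metis surj_pair)
  have S: "s \<in> S j" "s' \<in> S j'" using X by (auto simp: points_def)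
  obtain i where i: "i \<le> s" "i \<le> k j" "A_val k s j P = P i j + int s - int i"
    by (rule A_val_attained)
  obtain i' where i': "i' \<le> s'" "i' \<le> k j'" "A_val k s' j' P = P i' j' + int s' - int i'"
    by (rule A_val_attained)
  let ?m = "ereal (real_of_int (?A (s, j)))"
  have lower: "?m \<le> ?t p" if "p \<in> ?I" for p
  proof -
    obtain h l where p: "p = (h, l)" "h \<le> k l" using \<open>p \<in> ?I\<close> by auto
    show ?thesis
    proof (cases rule: term_value_cases[of P S h l])
      case 1
      then show ?thesis by (simp add: p)
    next
      case (2 t)
      then have "?A (s, j) \<le> ?A (t, l)" using X(5) by (auto simp: points_def)
      also have "\<dots> \<le> P h l + int t - int h"
        using A_val_le[of h t k l P] 2 p by (simp add: point_val_def)
      finally show ?thesis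
        unfolding p 2(3) ereal_less_eq(3) of_int_le_iff .
    qed
  qed
  have "?t (i, j) \<le> ?m" 
    using term_value_le[of s S j i P] S i by (simp add: point_val_def)
  then have t: "?t (i, j) = ?m" using lower[of "(i, j)"] i by (auto intro: antisym)
  have "?t (i', j') \<le> ?m" 
    using term_value_le[of s' S j' i' P] S i' X(4) by (simp add: point_val_def)
  then have t': "?t (i', j') = ?m" using lower[of "(i', j')"] i' by (auto intro: antisym)
  have "(i, j) \<noteq> (i', j')"
    using X(3,4) i i' by (auto simp: point_val_def)
  then show "min_twice ?t ?I"
    unfolding min_twice_def using t t' lower i i'
    by (intro bexI[of _ "(i, j)"] bexI[of _ "(i', j')"]) auto
qed

theorem is_solution_iff_points:
  fixes k :: "'n::finite \<Rightarrow> nat"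
  assumes "regular_system k P"
  shows "is_solution k P S \<longleftrightarrow>
    points S \<noteq> {} \<and> (\<forall>l. min_twice (point_val k (P l)) (points S))"
proof -
  have "{(i, j). i \<le> k j} = (\<lambda>(j, i). (i, j)) ` Sigma UNIV (\<lambda>j. {..k j})"
    by force
  then have fin: "finite {(i, j). i \<le> k j}" by simp
  have "(\<exists>j. S j \<noteq> {}) \<longleftrightarrow> points S \<noteq> {}" by (auto simp: points_def)
  then show ?thesis
    using assms min_twice_term_value_iff[of k _ S] card_argmins_ge_2_iff[OF fin]
    unfolding is_solution_def regular_system_def by metis
qed

lemma minimal_solution_points:
  assumes reg: "regular_system k P" and "is_minimal_solution k P S"
    and Y: "Y \<subseteq> points S" "Y \<noteq> {}" "\<forall>l. min_twice (point_val k (P l)) Y"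
  shows "points S = Y"
proof -
  define T where "T j = {s. (s, j) \<in> Y}" for j
  have T: "points T = Y" by (auto simp: points_def T_def)
  have "is_solution k P T" using is_solution_iff_points[OF reg, of T] Y T by simp
  moreover have "\<forall>j. T j \<subseteq> S j" using Y(1) by (auto simp: T_def points_def)
  ultimately have "T = S" using assms(2) unfolding is_minimal_solution_def by blast
  then show ?thesis using T by simp
qed

section \<open>Small and large points\<close>

lemma small_point_val_inj:
  assumes "regular_poly k P"
  shows "inj_on (point_val k P) (small k)"
  using assms unfolding regular_poly_def point_val_def small_def by blast

lemma large_point_val_less:
  assumes "(s, j) \<notin> small k" "s < t"
  shows "point_val k P (s, j) < point_val k P (t, j)"
  using assms A_val_above_order[of k j s P] A_val_above_order[of k j t P]
  by (simp add: point_val_def small_def)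

text \<open>Two equations cannot both attain their minimum at the same large point and a small point.\<close>

lemma generic_small:
  assumes "generic_system k P" "l \<noteq> m" "p \<in> small k" "q \<in> small k" "r \<notin> small k"
    and "point_val k (P l) r = point_val k (P l) p"
  shows "point_val k (P m) r \<noteq> point_val k (P m) q"
proof -
  obtain \<alpha> a \<beta> b s j where [simp]: "p = (\<alpha>, a)" "q = (\<beta>, b)" "r = (s, j)"
    by (cases p, cases q, cases r)
  have "A_val k (k j) j (P l) - A_val k \<alpha> a (P l) \<noteq> A_val k (k j) j (P m) - A_val k \<beta> b (P m)"
    using assms unfolding generic_system_def small_def by auto
  then show ?thesis
    using assms A_val_above_order[of k j s] by (auto simp: point_val_def small_def)
qed

text \<open>
  The first genericity condition for two unknowns: the identity and the transposition, the two
  permutations of the index type, give different sums.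
\<close>

lemma generic_leading:
  fixes k :: "2 \<Rightarrow> nat"
  assumes "generic_system k P"
  shows "A_val k (k 1) 1 (P 1) + A_val k (k 2) 2 (P 2) \<noteq> A_val k (k 2) 2 (P 1) + A_val k (k 1) 1 (P 2)"
proof
  assume eq: "A_val k (k 1) 1 (P 1) + A_val k (k 2) 2 (P 2) = A_val k (k 2) 2 (P 1) + A_val k (k 1) 1 (P 2)"
  let ?\<tau> = "Transposition.transpose (1::2) 2"
  have "id = ?\<tau>"
  proof (rule inj_onD)
    show "inj_on (\<lambda>\<sigma>. \<Sum>j\<in>UNIV. A_val k (k (\<sigma> j)) (\<sigma> j) (P j)) {\<sigma>. \<sigma> permutes UNIV}"
      using assms unfolding generic_system_def by blast
    show "(\<Sum>j\<in>UNIV. A_val k (k (id j)) (id j) (P j)) = (\<Sum>j\<in>UNIV. A_val k (k (?\<tau> j)) (?\<tau> j) (P j))"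
      using eq by (simp add: sum_2)
  qed (auto intro: permutes_id permutes_swap_id)
  then have "id (1::2) = ?\<tau> 1" by (rule fun_cong)
  then show False by simp
qed

text \<open>Since small points have distinct values, one of two attaining points is large.\<close>

lemma min_twice_large:
  assumes "regular_poly k P" "min_twice (point_val k P) X"
  shows "\<exists>p q. p \<in> X \<and> q \<in> X \<and> p \<noteq> q \<and> p \<notin> small k \<and>
    point_val k P p = point_val k P q \<and> (\<forall>r\<in>X. point_val k P p \<le> point_val k P r)"
  using assms(2) small_point_val_inj[OF assms(1)] unfolding min_twice_def inj_on_def by metis

section \<open>Minimal solutions of two equations\<close>

lemma minimal_solution_shape:
  fixes k :: "2 \<Rightarrow> nat"
  assumes reg: "regular_system k P" and gen: "generic_system k P"
    and min: "is_minimal_solution k P S"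
  obtains x y where "(x, 1) \<notin> small k" "(y, 2) \<notin> small k"
    "points S = {(x, 1), (y, 2)} \<union> points S \<inter> small k"
    "card (points S \<inter> small k) \<in> {1, 2}"
proof -
  let ?X = "points S"
  let ?A = "\<lambda>l. point_val k (P l)"
  have regl: "regular_poly k (P l)" for l using reg by (simp add: regular_system_def)
  have twice: "min_twice (?A l) ?X" for l
    using min is_solution_iff_points[OF reg] by (simp add: is_minimal_solution_def)
  obtain p q where pq: "p l \<in> ?X" "q l \<in> ?X" "p l \<noteq> q l" "p l \<notin> small k"
    "?A l (p l) = ?A l (q l)" "\<forall>r\<in>?X. ?A l (p l) \<le> ?A l r" for l
    using min_twice_large[OF regl twice] by metis
  have X: "?X = {p 1, q 1, p 2, q 2}"
  proof (rule minimal_solution_points[OF reg min])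
    show "{p 1, q 1, p 2, q 2} \<subseteq> ?X" using pq by blast
    show "\<forall>l. min_twice (?A l) {p 1, q 1, p 2, q 2}"
    proof
      fix l :: 2
      have "{p l, q l} \<subseteq> {p 1, q 1, p 2, q 2}" using exhaust_2[of l] by auto
      then show "min_twice (?A l) {p 1, q 1, p 2, q 2}"
        unfolding min_twice_def using pq by (intro bexI[of _ "p l"] bexI[of _ "q l"]) auto
    qed
  qed simp
  have attains: "\<exists>l. \<forall>s\<in>?X. ?A l r \<le> ?A l s" if "r \<in> ?X" for r
  proof -
    obtain l where "r = p l \<or> r = q l" using \<open>r \<in> ?X\<close> X by blast
    then show ?thesis using pq(5,6)[of l] by metis
  qed
  \<comment> \<open>Every point attains a minimum, and so it has no smaller large point of the same unknown.\<close>
  have not_less: "\<not> s < t" if "(s, j) \<in> ?X" "(t, j) \<in> ?X" "(s, j) \<notin> small k" for s t j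
    using attains[OF that(2)] that(1) large_point_val_less[OF that(3)] by (meson not_le)
  have unique: "r = s" if "r \<in> ?X - small k" "s \<in> ?X - small k" "snd r = snd s" for r s
    using not_less that by (metis DiffD1 DiffD2 linorder_neqE_nat prod.collapse)
  have ex: "\<exists>r \<in> ?X - small k. snd r = j" for j
  proof (rule ccontr)
    \<comment> \<open>Then there is a single large point; both attaining pairs consist of it and a small one.\<close>
    assume none: "\<not> ?thesis"
    have same: "r = s" if "r \<in> ?X - small k" "s \<in> ?X - small k" for r s
      using none unique[OF that] exhaust_2 that by (metis (full_types))
    have p: "p 1 = p 2" using same pq by blast
    have "q l \<in> small k" for l using same[of "p l" "q l"] pq by blast
    moreover have "?A 2 (p 1) = ?A 2 (q 2)" using pq(5)[of 2] p by simp
    moreover have "(1::2) \<noteq> 2" by simp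
    ultimately show False
      using generic_small[OF gen _ _ _ pq(4)[of 1] pq(5)[of 1], of 2 "q 2"] by blast
  qed
  obtain x where x: "(x, 1) \<in> ?X - small k" using ex[of 1] by auto
  obtain y where y: "(y, 2) \<in> ?X - small k" using ex[of 2] by auto
  have large: "r = (x, 1) \<or> r = (y, 2)" if "r \<in> ?X - small k" for r
    using unique[OF that x] unique[OF that y] exhaust_2[of "snd r"] by auto
  have split: "?X = {(x, 1), (y, 2)} \<union> ?X \<inter> small k"
    using large x y by blast
  have fin: "finite ?X" using X by simp
  have "card ?X = card {(x, 1::2), (y, 2)} + card (?X \<inter> small k)"
    using x y fin by (subst split, subst card_Un_disjoint) auto
  moreover have "card {(x, 1::2), (y, 2)} = 2" by simp
  moreover have "card ?X \<le> 4"
    unfolding X by (intro card_insert_le_m1) auto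
  ultimately have le: "card (?X \<inter> small k) \<le> 2" by linarith
  have "?X \<inter> small k \<noteq> {}"
  proof
    \<comment> \<open>Then both minima are attained at the two large points, against the first genericity condition.\<close>
    assume "?X \<inter> small k = {}"
    then have X2: "?X = {(x, 1), (y, 2)}" using split by simp
    have "?A l (x, 1) = ?A l (y, 2)" for l
      using pq(1-3,5)[of l] unfolding X2 by auto
    from this[of 1] this[of 2] show False
      using generic_leading[OF gen] x y A_val_above_order[of k 1 x] A_val_above_order[of k 2 y]
      by (simp add: point_val_def small_def)
  qed
  then have "card (?X \<inter> small k) \<noteq> 0" using fin by simp
  then have "card (?X \<inter> small k) = 1 \<or> card (?X \<inter> small k) = 2" using le by linarith
  then have "card (?X \<inter> small k) \<in> {1, 2}" by blast
  with x y split show ?thesis using that by blast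
qed

text \<open>
  Uniqueness in the tropical Cramer rule: two tropical lines, in each of which the minimum of
  \<open>a + x\<close>, \<open>b + y\<close>, \<open>c\<close> is attained twice, share at most one point if the three minors of the
  coefficient matrix are nonsingular.
\<close>

lemma tropical_lines_meet_once:
  fixes a b c a' b' c' x y x' y' :: int
  assumes "a + b' \<noteq> b + a'" "a - c \<noteq> a' - c'" "b - c \<noteq> b' - c'"
    and "(a + x = b + y \<and> a + x \<le> c) \<or> (a + x = c \<and> c \<le> b + y) \<or> (b + y = c \<and> c \<le> a + x)"
    and "(a' + x = b' + y \<and> a' + x \<le> c') \<or> (a' + x = c' \<and> c' \<le> b' + y)
      \<or> (b' + y = c' \<and> c' \<le> a' + x)"
    and "(a + x' = b + y' \<and> a + x' \<le> c) \<or> (a + x' = c \<and> c \<le> b + y') \<or> (b + y' = c \<and> c \<le> a + x')"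
    and "(a' + x' = b' + y' \<and> a' + x' \<le> c') \<or> (a' + x' = c' \<and> c' \<le> b' + y')
      \<or> (b' + y' = c' \<and> c' \<le> a' + x')"
  shows "x = x' \<and> y = y'"
  using assms by smt

text \<open>
  Of a set \<open>T\<close> of small points only a minimal one matters, so the minimum over \<open>u\<close>, \<open>v\<close> and \<open>T\<close>
  attained twice is a tropical line in the values of \<open>u\<close> and \<open>v\<close>.
\<close>

lemma min_twice_line:
  assumes "regular_poly k P" and "T \<subseteq> small k" "t \<in> T" "\<forall>r\<in>T. point_val k P t \<le> point_val k P r"
    and "min_twice (point_val k P) ({u, v} \<union> T)"
  shows "(point_val k P u = point_val k P v \<and> point_val k P u \<le> point_val k P t)
    \<or> (point_val k P u = point_val k P t \<and> point_val k P t \<le> point_val k P v)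
    \<or> (point_val k P v = point_val k P t \<and> point_val k P t \<le> point_val k P u)"
proof -
  obtain p q where pq: "p \<in> {u, v} \<union> T" "q \<in> {u, v} \<union> T" "p \<noteq> q" "p \<notin> small k"
    "point_val k P p = point_val k P q" "\<forall>r\<in>{u, v} \<union> T. point_val k P p \<le> point_val k P r"
    using min_twice_large[OF assms(1,5)] by blast
  have "p \<in> {u, v}" using pq(1,4) assms(2) by blast
  moreover have "point_val k P q = point_val k P t" if "q \<in> T"
    using that pq(5,6) assms(3,4) by (metis UnCI antisym)
  ultimately show ?thesis using pq assms(3) by auto
qed

lemma minimal_solution_determined:
  fixes k :: "2 \<Rightarrow> nat"
  assumes reg: "regular_system k P" and gen: "generic_system k P"
    and S: "is_minimal_solution k P S" and S': "is_minimal_solution k P S'"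
    and eq: "points S \<inter> small k = points S' \<inter> small k"
  shows "S = S'"
proof -
  define T where "T = points S \<inter> small k"
  let ?A = "\<lambda>l. point_val k (P l)"
  let ?c = "\<lambda>l j. A_val k (k j) j (P l)"
  have regl: "regular_poly k (P l)" for l using reg by (simp add: regular_system_def)
  obtain x y where xy: "(x, 1) \<notin> small k" "(y, 2) \<notin> small k"
    "points S = {(x, 1), (y, 2)} \<union> T" and T: "card T \<in> {1, 2}"
    using minimal_solution_shape[OF reg gen S] unfolding T_def by metis
  obtain x' y' where xy': "(x', 1) \<notin> small k" "(y', 2) \<notin> small k"
    "points S' = {(x', 1), (y', 2)} \<union> T"
    using minimal_solution_shape[OF reg gen S'] unfolding T_def eq by metis
  have fin: "finite T" "T \<noteq> {}" using T by (auto intro: card_ge_0_finite)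
  have "\<exists>t\<in>T. \<forall>r\<in>T. ?A l t \<le> ?A l r" for l
    using ex_min_if_finite[of "?A l ` T"] fin by (force simp: not_less)
  then obtain t where t: "t l \<in> T" "\<forall>r\<in>T. ?A l (t l) \<le> ?A l r" for l
    by metis
  have small: "T \<subseteq> small k" by (simp add: T_def)
  have twice: "min_twice (?A l) (points S)" "min_twice (?A l) (points S')" for l
    using S S' is_solution_iff_points[OF reg] by (auto simp: is_minimal_solution_def)
  have large: "?A l (s, j) = ?c l j + (int s - int (k j))" if "(s, j) \<notin> small k" for l s j
    using that A_val_above_order[of k j s "P l"] by (simp add: point_val_def small_def)
  note line = min_twice_line[OF regl small t, where u = "(x, 1)" and v = "(y, 2)",
      folded xy(3), OF twice(1), unfolded large[OF xy(1)] large[OF xy(2)]]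
  note line' = min_twice_line[OF regl small t, where u = "(x', 1)" and v = "(y', 2)",
      folded xy'(3), OF twice(2), unfolded large[OF xy'(1)] large[OF xy'(2)]]
  have small_minor: "?c 1 j - ?A 1 (t 1) \<noteq> ?c 2 j - ?A 2 (t 2)" for j
  proof -
    have "t 1 \<in> small k" "t 2 \<in> small k" using t small by auto
    then show ?thesis
      using gen unfolding generic_system_def small_def point_val_def by force
  qed
  have "int x - int (k 1) = int x' - int (k 1) \<and> int y - int (k 2) = int y' - int (k 2)"
    by (rule tropical_lines_meet_once[OF generic_leading[OF gen] small_minor small_minor
        line[of 1] line[of 2] line'[of 1] line'[of 2]])
  then show ?thesis using xy xy' by (intro points_inject) simp
qed

section \<open>The bound\<close>

lemma card_small:
  fixes k :: "2 \<Rightarrow> nat"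
  shows "finite (small k)" "card (small k) = k 1 + k 2"
proof -
  have *: "small k = (\<lambda>s. (s, 1)) ` {..<k 1} \<union> (\<lambda>s. (s, 2)) ` {..<k 2}"
    using exhaust_2 by (fastforce simp: small_def)
  show "finite (small k)" unfolding * by simp
  show "card (small k) = k 1 + k 2"
    unfolding * by (subst card_Un_disjoint) (auto simp: card_image inj_on_def)
qed

theorem theorem4p8:
  fixes k :: "2 \<Rightarrow> nat" and P :: "2 tlds"
  assumes "k 1 > 0" and "k 2 > 0"
    and "regular_system k P" and "generic_system k P"
  shows "finite {S. is_minimal_solution k P S} \<and>
    card {S. is_minimal_solution k P S} \<le> (k 1 + k 2) * (k 1 + k 2 + 1) div 2"
proof -
  let ?M = "{S. is_minimal_solution k P S}"
  let ?N = "\<lambda>m. {T. T \<subseteq> small k \<and> card T = m}"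
  let ?f = "\<lambda>S. points S \<inter> small k"
  let ?K = "k 1 + k 2"
  have inj: "inj_on ?f ?M"
    using minimal_solution_determined[OF assms(3,4)] by (auto intro: inj_onI)
  have sub: "?f ` ?M \<subseteq> ?N 1 \<union> ?N 2"
    using minimal_solution_shape[OF assms(3,4)] by fast
  have fin: "finite (?N 1 \<union> ?N 2)"
    using card_small(1)[of k] by simp
  have "card (?N 1 \<union> ?N 2) = card (?N 1) + card (?N 2)"
    using fin by (intro card_Un_disjoint) auto
  also have "\<dots> = (?K choose 1) + (?K choose 2)"
    by (simp only: n_subsets[OF card_small(1)] card_small(2))
  also have "\<dots> = ?K * (?K + 1) div 2"
    by (cases ?K) (simp_all add: choose_two algebra_simps)
  finally show ?thesis
    using card_inj_on_le[OF inj sub fin] inj_on_finite[OF inj sub fin] by simp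
qed

end
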